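(* Let $\mathcal{H}$ be a non-trivial Hilbert space, let $I$ be $\mathbb{N}$ or $\mathbb{Z}$, and suppose $\{f_n\}_{n\in I}\subseteq\mathcal{H}$ does frame reconstruction (respectively, unconditional frame reconstruction) with $B\in B(\mathcal{H})$ and $$M:=\sup_n\|f_n\|<\infty.$$ Suppose further that $\{h_n\}_{n\in I}\subseteq\mathcal{H}$ satisfies $$\sum_{n\in I}\|f_n-h_n\|\leq\frac12\left(\sqrt{M^2+\frac1{\|B\|}}-M\right).$$ Then $\{h_n\}_{n\in I}$ also does frame reconstruction (respectively, unconditional frame reconstruction) with the operator $(T^{-1})^*B$, where $T:\mathcal{H}\to\mathcal{H}$ is the (well-defined, bounded, invertible) operator $$Tf:=\sum_{n\in I}\langle f,Bh_n\rangle h_n,$$ the sum being the norm limit of the partial sums $\sum_{n=0}^{N}$ if $I=\mathbb{N}$ and of $\sum_{n=-N}^{N}$ if $I=\mathbb{Z}$. Moreover, if $\{f_n\}_{n\in I}$ is not a frame, then $\{h_n\}_{n\in I}$ is also not a frame.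
   Context: $B(\mathcal{H})$ is the space of bounded linear operators on $\mathcal{H}$; inner products are linear in the first variable; $\mathbb{N}=\{0,1,2,\dots\}$. A sequence $\{f_n\}_{n\in I}\subseteq\mathcal{H}$ ($I=\mathbb{N}$ or $\mathbb{Z}$) does frame reconstruction with $B\in B(\mathcal{H})$ if for every $f\in\mathcal{H}$ one has $\sum_{n=0}^{\infty}\langle f,Bf_n\rangle f_n=f$ when $I=\mathbb{N}$, respectively $\lim_{M\to\infty}\sum_{n=-M}^{M}\langle f,Bf_n\rangle f_n=f$ when $I=\mathbb{Z}$, with convergence in norm. It does unconditional frame reconstruction with $B$ if moreover this series converges unconditionally for every $f\in\mathcal{H}$. $\{f_n\}$ is a frame for $\mathcal{H}$ if there are $A,C>0$ with $A\|f\|^2\le\sum_n|\langle f,f_n\rangle|^2\le C\|f\|^2$ for all $f\in\mathcal{H}$. *)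

theory Defs
  imports "HOL-Analysis.Analysis"
begin

text \<open>
  The Analysis library only has real inner product spaces.  A complex Hilbert space is a Banach
  space whose norm comes from a complex inner product, linear in its first argument;
  positive definiteness of the inner product follows from \<open>cinner_self\<close>.
\<close>

class complex_hilbert = banach +
  fixes scaleC :: "complex \<Rightarrow> 'a \<Rightarrow> 'a"  (infixr \<open>*\<^sub>C\<close> 75)
    and cinner :: "'a \<Rightarrow> 'a \<Rightarrow> complex"
  assumes scaleC_of_real: "scaleC (complex_of_real r) x = scaleR r x"
    and scaleC_add_right: "scaleC a (x + y) = scaleC a x + scaleC a y"
    and scaleC_add_left: "scaleC (a + b) x = scaleC a x + scaleC b x"
    and scaleC_scaleC: "scaleC a (scaleC b x) = scaleC (a * b) x"
    and cinner_commute: "cinner x y = cnj (cinner y x)"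
    and cinner_add_left: "cinner (x + y) z = cinner x z + cinner y z"
    and cinner_scaleC_left: "cinner (scaleC a x) y = a * cinner x y"
    and cinner_self: "cinner x x = complex_of_real ((norm x)\<^sup>2)"

instantiation complex :: complex_hilbert
begin

definition "scaleC_complex (a :: complex) (x :: complex) = a * x"

definition "cinner_complex (x :: complex) (y :: complex) = x * cnj y"

instance
  by standard
    (simp_all only: scaleC_complex_def cinner_complex_def scaleR_conv_of_real distrib_left
      distrib_right mult.assoc complex_norm_square complex_cnj_mult complex_cnj_cnj
      mult.commute[of "cnj _"])

end

definition bounded_clinear :: "('a::complex_hilbert \<Rightarrow> 'a) \<Rightarrow> bool" where
  "bounded_clinear T \<longleftrightarrow> bounded_linear T \<and> (\<forall>c x. T (c *\<^sub>C x) = c *\<^sub>C T x)"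

definition cadjoint :: "('a::complex_hilbert \<Rightarrow> 'a) \<Rightarrow> 'a \<Rightarrow> 'a" where
  "cadjoint T = (THE S. \<forall>x y. cinner (T x) y = cinner x (S y))"

text \<open>
  A sequence indexed by \<open>I = \<nat>\<close> or \<open>I = \<int>\<close> is a function on \<open>int\<close>, of which only the values on
  \<open>I :: int set\<close> matter.  The partial sum below is then the sum over \<open>n = 0, \<dots>, N\<close>
  if \<open>I = \<nat>\<close> and over \<open>n = - N, \<dots>, N\<close> if \<open>I = \<int>\<close>.
\<close>

definition partial_sum :: "int set \<Rightarrow> (int \<Rightarrow> 'a::comm_monoid_add) \<Rightarrow> nat \<Rightarrow> 'a" where
  "partial_sum I g N = (\<Sum>n\<in>I \<inter> {- int N..int N}. g n)"

lemma partial_sum_Nats: "partial_sum \<nat> g N = (\<Sum>n=0..N. g (int n))"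
proof -
  have "(\<nat> :: int set) \<inter> {- int N..int N} = int ` {0..N}"
    by (auto simp: Nats_def image_iff)
  then show ?thesis
    by (simp add: partial_sum_def sum.reindex)
qed

lemma partial_sum_Ints: "partial_sum \<int> g N = (\<Sum>n=- int N..int N. g n)"
proof -
  have "(\<int> :: int set) = UNIV"
    by (metis Ints_of_int UNIV_eq_I of_int_eq_id id_apply)
  then show ?thesis
    by (simp add: partial_sum_def)
qed

definition does_frame_reconstruction ::
    "int set \<Rightarrow> (int \<Rightarrow> 'a::complex_hilbert) \<Rightarrow> ('a \<Rightarrow> 'a) \<Rightarrow> bool" where
  "does_frame_reconstruction I f B \<longleftrightarrow>
     bounded_clinear B \<and>
     (\<forall>x. partial_sum I (\<lambda>n. cinner x (B (f n)) *\<^sub>C f n) \<longlonglongrightarrow> x)"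

text \<open>
  Unconditional convergence is summability over the net of finite subsets of the index set.
\<close>

definition does_unconditional_frame_reconstruction ::
    "int set \<Rightarrow> (int \<Rightarrow> 'a::complex_hilbert) \<Rightarrow> ('a \<Rightarrow> 'a) \<Rightarrow> bool" where
  "does_unconditional_frame_reconstruction I f B \<longleftrightarrow>
     does_frame_reconstruction I f B \<and>
     (\<forall>x. (\<lambda>n. cinner x (B (f n)) *\<^sub>C f n) summable_on I)"

definition is_frame :: "int set \<Rightarrow> (int \<Rightarrow> 'a::complex_hilbert) \<Rightarrow> bool" where
  "is_frame I f \<longleftrightarrow>
     (\<exists>A>0. \<exists>C>0. \<forall>x.
        (\<lambda>n. (cmod (cinner x (f n)))\<^sup>2) summable_on I \<and>
        A * (norm x)\<^sup>2 \<le> (\<Sum>\<^sub>\<infinity>n\<in>I. (cmod (cinner x (f n)))\<^sup>2) \<and>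
        (\<Sum>\<^sub>\<infinity>n\<in>I. (cmod (cinner x (f n)))\<^sup>2) \<le> C * (norm x)\<^sup>2)"

end

theory Submission imports Defs begin

text \<open>
  Put \<open>e\<^sub>n = f\<^sub>n - h\<^sub>n\<close>. Then \<open>\<langle>x, B f\<^sub>n\<rangle> f\<^sub>n - \<langle>x, B h\<^sub>n\<rangle> h\<^sub>n = \<langle>x, B f\<^sub>n\<rangle> e\<^sub>n + \<langle>x, B e\<^sub>n\<rangle> h\<^sub>n\<close>, so
  \<open>T = 1 - D\<close> where \<open>D\<close> is a sum of two absolutely convergent series of rank-one operators, and the
  bound on \<open>\<Sum>\<parallel>e\<^sub>n\<parallel>\<close> makes the norm of \<open>D\<close> at most 1/2. The adjoint of \<open>D\<close> is the sum of the
  adjoint series, so \<open>(T\<^sup>-\<^sup>1)\<^sup>*\<close> is the Neumann inverse of \<open>1 - D\<^sup>*\<close> and no Riesz representation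
  theorem is needed. For the frame property, if \<open>h\<close> is a frame then \<open>f\<close> has an upper frame bound,
  and a sequence with an upper frame bound that does frame reconstruction has a lower one by the
  Cauchy-Schwarz inequality.
\<close>

section \<open>Complex inner products\<close>

lemma cinner_add_right: "cinner x (y + z) = cinner x y + cinner x (z::'a::complex_hilbert)"
  by (metis cinner_add_left cinner_commute complex_cnj_add)

lemma cinner_scaleC_right: "cinner x (a *\<^sub>C y) = cnj a * cinner x (y::'a::complex_hilbert)"
  by (metis cinner_commute cinner_scaleC_left complex_cnj_mult)

text \<open>The normed-space axioms give homogeneity for real scalars only; for complex scalars it
  is recovered from \<open>cinner_self\<close>.\<close>

lemma norm_scaleC: "norm (a *\<^sub>C x) = cmod a * norm (x::'a::complex_hilbert)"
proof -
  have "complex_of_real ((norm (a *\<^sub>C x))\<^sup>2) = a * cnj a * complex_of_real ((norm x)\<^sup>2)"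
    by (simp only: cinner_self[symmetric] cinner_scaleC_left cinner_scaleC_right mult_ac)
  also have "\<dots> = complex_of_real ((cmod a * norm x)\<^sup>2)"
    by (simp only: complex_norm_square[symmetric] of_real_mult[symmetric] power_mult_distrib)
  finally have "(norm (a *\<^sub>C x))\<^sup>2 = (cmod a * norm x)\<^sup>2"
    by (simp only: of_real_eq_iff)
  then show ?thesis
    by simp
qed

lemma additive_cinner_left: "Modules.additive (\<lambda>x. cinner x (y::'a::complex_hilbert))"
  by (simp add: Modules.additive_def cinner_add_left)

lemma additive_cinner_right: "Modules.additive (cinner (x::'a::complex_hilbert))"
  by (simp add: Modules.additive_def cinner_add_right)

lemmas cinner_zero_left [simp] = Modules.additive.zero[OF additive_cinner_left]
  and cinner_zero_right [simp] = Modules.additive.zero[OF additive_cinner_right]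
  and cinner_diff_left = Modules.additive.diff[OF additive_cinner_left]
  and cinner_diff_right = Modules.additive.diff[OF additive_cinner_right]
  and cinner_sum_left = Modules.additive.sum[OF additive_cinner_left]

lemma cmod_cinner_self: "cmod (cinner x x) = (norm (x::'a::complex_hilbert))\<^sup>2"
  by (simp add: cinner_self norm_power)

lemma cmod_cinner_commute: "cmod (cinner x y) = cmod (cinner y (x::'a::complex_hilbert))"
  by (metis cinner_commute complex_mod_cnj)

text \<open>The component of \<open>x\<close> orthogonal to \<open>y\<close>, multiplied by
  \<open>r = (norm y)^2\<close> to avoid division, is \<open>r x - c y\<close> with
  \<open>c = cinner x y\<close>; its squared norm is nonnegative.\<close>

lemma Cauchy_Schwarz_cinner: "cmod (cinner x y) \<le> norm x * norm (y::'a::complex_hilbert)"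
proof (cases "y = 0")
  case False
  define c where "c = cinner x y"
  define r where "r = complex_of_real ((norm y)\<^sup>2)"
  have yx: "cinner y x = cnj c" and yy: "cinner y y = r"
    unfolding c_def r_def by (rule cinner_commute, rule cinner_self)
  have "cinner (r *\<^sub>C x - c *\<^sub>C y) (r *\<^sub>C x - c *\<^sub>C y) = r * (r * cinner x x - c * cnj c)"
    by (simp add: cinner_diff_left cinner_diff_right cinner_scaleC_left cinner_scaleC_right
        yx yy c_def[symmetric] algebra_simps) (simp add: r_def algebra_simps)
  then have "complex_of_real ((norm (r *\<^sub>C x - c *\<^sub>C y))\<^sup>2)
      = complex_of_real ((norm y)\<^sup>2 * ((norm y)\<^sup>2 * (norm x)\<^sup>2 - (cmod c)\<^sup>2))"
    by (simp only: cinner_self r_def of_real_mult of_real_diff complex_norm_square)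
  then have "(norm (r *\<^sub>C x - c *\<^sub>C y))\<^sup>2 = (norm y)\<^sup>2 * ((norm y)\<^sup>2 * (norm x)\<^sup>2 - (cmod c)\<^sup>2)"
    by (simp only: of_real_eq_iff)
  then have "0 \<le> (norm y)\<^sup>2 * ((norm y)\<^sup>2 * (norm x)\<^sup>2 - (cmod c)\<^sup>2)"
    by (metis zero_le_power2)
  then have "(cmod c)\<^sup>2 \<le> (norm x * norm y)\<^sup>2"
    using False by (simp add: zero_le_mult_iff power_mult_distrib mult.commute)
  then show ?thesis
    unfolding c_def by (rule power2_le_imp_le) simp
qed simp

lemma bounded_linear_cinner_left: "bounded_linear (\<lambda>x. cinner x (y::'a::complex_hilbert))"
proof (rule bounded_linear_intro[where K = "norm y"])
  show "cinner (r *\<^sub>R x) y = r *\<^sub>R cinner x y" for r x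
    by (simp add: scaleC_of_real[of r x, symmetric] cinner_scaleC_left scaleR_conv_of_real)
qed (simp_all add: cinner_add_left Cauchy_Schwarz_cinner)

lemma bounded_linear_cinner_right: "bounded_linear (cinner (x::'a::complex_hilbert))"
proof (rule bounded_linear_intro[where K = "norm x"])
  show "cmod (cinner x y) \<le> norm y * norm x" for y
    using Cauchy_Schwarz_cinner[of x y] by (simp add: mult.commute)
  show "cinner x (r *\<^sub>R y) = r *\<^sub>R cinner x y" for r y
    by (simp add: scaleC_of_real[of r y, symmetric] cinner_scaleC_right scaleR_conv_of_real)
qed (simp add: cinner_add_right)

lemma bounded_linear_scaleC: "bounded_linear (scaleC c :: 'a::complex_hilbert \<Rightarrow> 'a)"
proof (rule bounded_linear_intro[where K = "cmod c"])
  show "c *\<^sub>C (r *\<^sub>R x) = r *\<^sub>R c *\<^sub>C x" for r and x :: 'a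
    by (simp add: scaleC_of_real[symmetric] scaleC_scaleC mult.commute)
qed (simp_all add: scaleC_add_right norm_scaleC mult.commute)

lemmas scaleC_diff_right = linear_diff[OF bounded_linear.linear[OF bounded_linear_scaleC]]

lemma additive_scaleC_left: "Modules.additive (\<lambda>c. c *\<^sub>C (x::'a::complex_hilbert))"
  by (simp add: Modules.additive_def scaleC_add_left)

lemmas scaleC_zero_left [simp] = Modules.additive.zero[OF additive_scaleC_left]
  and scaleC_diff_left = Modules.additive.diff[OF additive_scaleC_left]

lemma cinner_eqI:
  assumes "\<And>x. cinner x y = cinner x (z::'a::complex_hilbert)"
  shows "y = z"
proof -
  have "cinner (y - z) (y - z) = 0"
    using assms[of "y - z"] by (simp add: cinner_diff_right)
  then show ?thesis
    by (simp add: cinner_self)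
qed

section \<open>Adjoints and the Neumann inverse\<close>

lemma bounded_clinearI:
  fixes T :: "'a::complex_hilbert \<Rightarrow> 'a"
  assumes "\<And>x y. T (x + y) = T x + T y" "\<And>c x. T (c *\<^sub>C x) = c *\<^sub>C T x"
    and "\<And>x. norm (T x) \<le> norm x * K"
  shows "bounded_clinear T"
  unfolding bounded_clinear_def
  using assms by (auto intro!: bounded_linear_intro simp: scaleC_of_real[symmetric])

lemma bounded_clinear_compose:
  fixes S T :: "'a::complex_hilbert \<Rightarrow> 'a"
  assumes "bounded_clinear S" "bounded_clinear T"
  shows "bounded_clinear (S \<circ> T)"
  using assms bounded_linear_compose[of S T] by (simp add: bounded_clinear_def comp_def)

lemma bounded_clinear_add:
  assumes "bounded_clinear S" "bounded_clinear T"
  shows "bounded_clinear (\<lambda>x. S x + T x)"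
  using assms by (simp add: bounded_clinear_def bounded_linear_add scaleC_add_right)

lemma bounded_clinear_id_diff:
  assumes "bounded_clinear D"
  shows "bounded_clinear (\<lambda>x. x - D x)"
  using assms
  by (simp add: bounded_clinear_def bounded_linear_sub bounded_linear_ident scaleC_diff_right)

text \<open>The inner product is nondegenerate, so adjoints are unique and any explicit candidate
  evaluates the definite description in \<open>cadjoint\<close>.\<close>

lemma cadjoint_eqI:
  assumes "\<And>x y. cinner (T x) y = cinner x (S y)"
  shows "cadjoint T = S"
  unfolding cadjoint_def
proof (rule the_equality)
  show "R = S" if "\<forall>x y. cinner (T x) y = cinner x (R y)" for R
    by (rule ext, rule cinner_eqI) (metis that assms)
qed (use assms in blast)

text \<open>Testing the adjoint relation at \<open>x = D' y\<close> bounds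
  \<open>(norm (D' y))^2\<close> by \<open>q * norm (D' y) * norm y\<close>; one factor cancels.
  This transfers the contraction constant to the adjoint without a second estimate.\<close>

lemma adjoint_norm_le:
  fixes D D' :: "'a::complex_hilbert \<Rightarrow> 'a"
  assumes adj: "\<And>x y. cinner (D x) y = cinner x (D' y)"
    and bound: "\<And>x. norm (D x) \<le> q * norm x"
  shows "norm (D' y) \<le> q * norm y"
proof (cases "D' y = 0")
  case True
  \<comment> \<open>The sign comes from \<open>bound\<close> itself, whose left side is a
    norm.\<close>
  have "0 \<le> q * norm y"
    using bound[of y] norm_ge_zero order_trans by blast
  with True show ?thesis
    by simp
next
  case False
  have "(norm (D' y))\<^sup>2 = cmod (cinner (D (D' y)) y)"
    by (simp add: adj cmod_cinner_self)
  also have "\<dots> \<le> norm (D (D' y)) * norm y"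
    by (rule Cauchy_Schwarz_cinner)
  also have "\<dots> \<le> q * norm (D' y) * norm y"
    by (intro mult_right_mono bound) simp
  finally have "norm (D' y) * norm (D' y) \<le> norm (D' y) * (q * norm y)"
    by (simp add: power2_eq_square algebra_simps)
  with False show ?thesis
    by simp
qed

text \<open>The estimate \<open>(1 - q) * norm x \<le> norm (x - D x)\<close> gives injectivity and
  bounds the inverse; completeness gives surjectivity through a fixed point.\<close>

lemma Neumann_inverse:
  assumes D: "bounded_clinear D"
    and bound: "\<And>x. norm (D x) \<le> q * norm x" and q: "0 \<le> q" "q < 1"
  shows "bij (\<lambda>x. x - D x)" and "bounded_clinear (inv (\<lambda>x. x - D x))"
proof -
  define T where "T = (\<lambda>x. x - D x)"
  have D_diff: "D (x - y) = D x - D y" for x y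
    using D by (simp add: bounded_clinear_def bounded_linear.linear linear_diff)
  have T_clin: "bounded_clinear T"
    unfolding T_def by (rule bounded_clinear_id_diff[OF D])
  have T_diff: "T (x - y) = T x - T y" for x y
    by (simp add: T_def D_diff)
  have below: "norm x \<le> norm (T x) * inverse (1 - q)" for x
  proof -
    have "norm x - norm (D x) \<le> norm (T x)"
      unfolding T_def by (rule norm_triangle_ineq2)
    then have "(1 - q) * norm x \<le> norm (T x)"
      using bound[of x] by (simp add: algebra_simps)
    then show ?thesis
      using q by (simp add: field_simps)
  qed
  have "inj T"
  proof (rule injI)
    fix x y assume "T x = T y"
    then show "x = y"
      using below[of "x - y"] by (simp add: T_diff)
  qed
  moreover have "surj T"
  proof -
    have "\<exists>x. T x = y" for y
    proof -
      \<comment> \<open>A fixed point of the contraction sending \<open>x\<close> to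
        \<open>y + D x\<close> is exactly a solution of \<open>x - D x = y\<close>.\<close>
      have "\<exists>!x\<in>UNIV. y + D x = x"
        by (rule Banach_fix[OF _ _ q])
          (use bound in \<open>auto simp: complete_UNIV dist_norm D_diff[symmetric]\<close>)
      then obtain x where "y + D x = x"
        by blast
      then have "T x = y"
        by (simp add: T_def algebra_simps)
      then show ?thesis ..
    qed
    then show ?thesis
      by (metis surjI)
  qed
  ultimately show bij: "bij (\<lambda>x. x - D x)"
    unfolding T_def by (simp add: bij_def)
  then have bijT: "bij T"
    by (simp add: T_def)
  have T_inv: "T (inv T x) = x" and inv_T: "inv T (T x) = x" for x
    using bijT by (simp_all add: bij_inv_eq_iff bij_is_surj surj_f_inv_f bij_is_inj)
  have "bounded_clinear (inv T)"
  proof (rule bounded_clinearI)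
    have lin: "linear T" and hom: "T (c *\<^sub>C x) = c *\<^sub>C T x" for c x
      using T_clin by (simp_all add: bounded_clinear_def bounded_linear.linear)
    show "inv T (x + y) = inv T x + inv T y" for x y
      using linear_add[OF lin, of "inv T x" "inv T y"] by (metis T_inv inv_T)
    show "inv T (c *\<^sub>C x) = c *\<^sub>C inv T x" for c x
      using hom[of c "inv T x"] by (metis T_inv inv_T)
    show "norm (inv T x) \<le> norm x * inverse (1 - q)" for x
      using below[of "inv T x"] by (simp add: T_inv)
  qed
  then show "bounded_clinear (inv (\<lambda>x. x - D x))"
    by (simp add: T_def)
qed

text \<open>This is the rule that the adjoint of an inverse is the inverse of the adjoint: apply the
  relation at \<open>inv T x\<close> and \<open>inv T' y\<close>.\<close>

lemma cinner_inv_left: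
  assumes "\<And>x y. cinner (T x) y = cinner x (T' y)" and "bij T" "bij T'"
  shows "cinner (inv T x) y = cinner x (inv T' y)"
  using assms(1)[of "inv T x" "inv T' y"] assms(2,3) by (simp add: bij_is_surj surj_f_inv_f)

section \<open>Absolutely convergent series of rank-one operators\<close>

lemma infsum_of_bounded_linear:
  assumes "bounded_linear T" "g summable_on I"
  shows "infsum (\<lambda>n. T (g n)) I = T (infsum g I)"
  using has_sum_bounded_linear[OF assms(1) has_sum_infsum[OF assms(2)]]
  by (rule infsumI)

definition nuclear ::
    "'i set \<Rightarrow> ('i \<Rightarrow> 'a::complex_hilbert) \<Rightarrow> ('i \<Rightarrow> 'a) \<Rightarrow> 'a \<Rightarrow> 'a" where
  "nuclear I u v x = (\<Sum>\<^sub>\<infinity>n\<in>I. cinner x (u n) *\<^sub>C v n)"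

context
  fixes I :: "'i set" and u v :: "'i \<Rightarrow> 'a::complex_hilbert"
  assumes summable_norms: "(\<lambda>n. norm (u n) * norm (v n)) summable_on I"
begin

lemma norm_nuclear_term:
  "norm (cinner x (u n) *\<^sub>C v n) \<le> norm x * (norm (u n) * norm (v n))"
  using mult_right_mono[OF Cauchy_Schwarz_cinner[of x "u n"], of "norm (v n)"]
  by (simp add: norm_scaleC mult.assoc)

lemma nuclear_abs_summable: "(\<lambda>n. norm (cinner x (u n) *\<^sub>C v n)) summable_on I"
proof (rule summable_on_comparison_test)
  show "(\<lambda>n. norm x * (norm (u n) * norm (v n))) summable_on I"
    by (rule summable_on_cmult_right) (rule summable_norms)
qed (rule norm_nuclear_term norm_ge_zero)+

lemma nuclear_summable: "(\<lambda>n. cinner x (u n) *\<^sub>C v n) summable_on I"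
  by (rule abs_summable_summable) (rule nuclear_abs_summable)

lemma norm_nuclear_le: "norm (nuclear I u v x) \<le> (\<Sum>\<^sub>\<infinity>n\<in>I. norm (u n) * norm (v n)) * norm x"
proof -
  have "norm (nuclear I u v x) \<le> (\<Sum>\<^sub>\<infinity>n\<in>I. norm (cinner x (u n) *\<^sub>C v n))"
    unfolding nuclear_def by (rule norm_infsum_bound) (rule nuclear_abs_summable)
  also have "\<dots> \<le> (\<Sum>\<^sub>\<infinity>n\<in>I. norm x * (norm (u n) * norm (v n)))"
    by (intro infsum_mono nuclear_abs_summable summable_on_cmult_right summable_norms
        norm_nuclear_term)
  also have "\<dots> = (\<Sum>\<^sub>\<infinity>n\<in>I. norm (u n) * norm (v n)) * norm x"
    by (simp add: infsum_cmult_right summable_norms mult.commute)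
  finally show ?thesis .
qed

lemma bounded_clinear_nuclear: "bounded_clinear (nuclear I u v)"
proof (rule bounded_clinearI)
  show "nuclear I u v (x + y) = nuclear I u v x + nuclear I u v y" for x y
    by (simp add: nuclear_def cinner_add_left scaleC_add_left infsum_add nuclear_summable)
  show "nuclear I u v (c *\<^sub>C x) = c *\<^sub>C nuclear I u v x" for c x
    using infsum_of_bounded_linear[OF bounded_linear_scaleC nuclear_summable, of c x]
    by (simp add: nuclear_def cinner_scaleC_left scaleC_scaleC comp_def)
  show "norm (nuclear I u v x) \<le> norm x * (\<Sum>\<^sub>\<infinity>n\<in>I. norm (u n) * norm (v n))" for x
    using norm_nuclear_le[of x] by (simp add: mult.commute)
qed

end

text \<open>The adjoint of a rank-one term exchanges \<open>u n\<close> and \<open>v n\<close>. Each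
  slot of the inner product is bounded and real-linear, the second one although it is
  conjugate-linear, so both commute with the infinite sum.\<close>

lemma cinner_nuclear:
  assumes "(\<lambda>n. norm (u n) * norm (v n)) summable_on I"
  shows "cinner (nuclear I u v x) y = cinner x (nuclear I v u y)"
proof -
  have assms': "(\<lambda>n. norm (v n) * norm (u n)) summable_on I"
    using assms by (simp add: mult.commute)
  have "cinner (nuclear I u v x) y = (\<Sum>\<^sub>\<infinity>n\<in>I. cinner (cinner x (u n) *\<^sub>C v n) y)"
    using infsum_of_bounded_linear[OF bounded_linear_cinner_left nuclear_summable[OF assms]]
    by (simp add: nuclear_def comp_def)
  also have "\<dots> = (\<Sum>\<^sub>\<infinity>n\<in>I. cinner x (cinner y (v n) *\<^sub>C u n))"
    by (intro infsum_cong)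
      (simp add: cinner_scaleC_left cinner_scaleC_right cinner_commute[symmetric] mult.commute)
  also have "\<dots> = cinner x (nuclear I v u y)"
    using infsum_of_bounded_linear[OF bounded_linear_cinner_right nuclear_summable[OF assms']]
    by (simp add: nuclear_def comp_def)
  finally show ?thesis .
qed

section \<open>Unconditional sums and ordered partial sums\<close>

lemma summable_on_diff:
  fixes g k :: "'i \<Rightarrow> 'b::topological_ab_group_add"
  assumes "g summable_on I" "k summable_on I"
  shows "(\<lambda>n. g n - k n) summable_on I"
  using summable_on_add[OF assms(1) iffD2[OF summable_on_uminus assms(2)]] by simp

text \<open>The windows \<open>I \<inter> {- int N..int N}\<close> eventually contain every finite
  subset of \<open>I\<close>, so the partial sums follow the net of finite sums.\<close>

lemma partial_sum_tendsto_infsum: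
  fixes g :: "int \<Rightarrow> 'b::{comm_monoid_add,t2_space}"
  assumes "g summable_on I"
  shows "partial_sum I g \<longlonglongrightarrow> infsum g I"
proof -
  have "filterlim (\<lambda>N. I \<inter> {- int N..int N}) (finite_subsets_at_top I) sequentially"
    unfolding filterlim_finite_subsets_at_top
  proof (intro allI impI)
    fix X assume X: "finite X \<and> X \<subseteq> I"
    then obtain b where b: "\<And>n. n \<in> X \<Longrightarrow> \<bar>n\<bar> \<le> b"
      using finite_imageI[of X abs] by (metis bdd_above.E bdd_above_finite imageI)
    show "\<forall>\<^sub>F N in sequentially. finite (I \<inter> {- int N..int N})
        \<and> X \<subseteq> I \<inter> {- int N..int N} \<and> I \<inter> {- int N..int N} \<subseteq> I"
      using eventually_ge_at_top[of "nat b"]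
    proof eventually_elim
      case (elim N)
      then show ?case
        using X b by (force simp: abs_le_iff)
    qed
  qed
  then show ?thesis
    unfolding partial_sum_def
    using has_sum_infsum[OF assms] unfolding has_sum_def by (rule filterlim_compose[rotated])
qed

lemma partial_sum_diff:
  fixes g k :: "int \<Rightarrow> 'b::ab_group_add"
  shows "partial_sum I (\<lambda>n. g n - k n) = (\<lambda>N. partial_sum I g N - partial_sum I k N)"
  by (simp add: fun_eq_iff partial_sum_def sum_subtractf)

section \<open>Frame bounds\<close>

text \<open>Synthesis is adjoint to analysis, so it inherits the bound: expand
  \<open>cinner v v\<close> for the synthesized vector \<open>v\<close>, apply Cauchy-Schwarz and
  the hypothesis at \<open>v\<close>, and cancel \<open>(norm v)^2\<close>.\<close>

lemma norm_synthesis_le: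
  fixes f :: "'i \<Rightarrow> 'a::complex_hilbert"
  assumes Bessel: "\<And>x. (\<Sum>n\<in>F. (cmod (cinner x (f n)))\<^sup>2) \<le> C * (norm x)\<^sup>2"
    and C: "0 \<le> C"
  shows "(norm (\<Sum>n\<in>F. a n *\<^sub>C f n))\<^sup>2 \<le> C * (\<Sum>n\<in>F. (cmod (a n))\<^sup>2)"
proof -
  define v where "v = (\<Sum>n\<in>F. a n *\<^sub>C f n)"
  have "cinner v v = (\<Sum>n\<in>F. a n * cinner (f n) v)"
    by (subst (1) v_def) (simp add: cinner_sum_left cinner_scaleC_left)
  then have "(norm v)\<^sup>2 = cmod (\<Sum>n\<in>F. a n * cinner (f n) v)"
    by (metis cmod_cinner_self)
  also have "\<dots> \<le> (\<Sum>n\<in>F. cmod (a n) * cmod (cinner v (f n)))"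
    by (rule order_trans[OF norm_sum]) (simp add: norm_mult cmod_cinner_commute)
  finally have "((norm v)\<^sup>2)\<^sup>2 \<le> (\<Sum>n\<in>F. cmod (a n) * cmod (cinner v (f n)))\<^sup>2"
    by (rule power_mono) simp
  also have "\<dots> \<le> (\<Sum>n\<in>F. (cmod (a n))\<^sup>2) * (\<Sum>n\<in>F. (cmod (cinner v (f n)))\<^sup>2)"
    by (rule Cauchy_Schwarz_ineq_sum)
  also have "\<dots> \<le> (\<Sum>n\<in>F. (cmod (a n))\<^sup>2) * (C * (norm v)\<^sup>2)"
    by (intro mult_left_mono Bessel sum_nonneg) simp
  finally have le: "(norm v)\<^sup>2 * (norm v)\<^sup>2 \<le> (norm v)\<^sup>2 * (C * (\<Sum>n\<in>F. (cmod (a n))\<^sup>2))"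
    by (simp add: power2_eq_square[of "(norm v)\<^sup>2"] mult.commute mult.left_commute)
  show ?thesis
  proof (cases "v = 0")
    case False
    then have "0 < (norm v)\<^sup>2"
      by simp
    with le show ?thesis
      unfolding v_def by (rule mult_left_le_imp_le)
  next
    case True
    with C show ?thesis
      by (simp add: v_def[symmetric] sum_nonneg)
  qed
qed

text \<open>With an adjoint of \<open>B\<close> one would move \<open>B\<close> onto
  \<open>x\<close>. Instead the sum \<open>s\<close> of squares is written as
  \<open>cinner (B v) x\<close>, where \<open>v\<close> is synthesized from the same coefficients;
  the synthesis bound then gives
  \<open>s^2 \<le> s * (C * (onorm B)^2 * (norm x)^2)\<close>.\<close>

lemma analysis_sum_le:
  fixes f :: "'i \<Rightarrow> 'a::complex_hilbert"
  assumes Bessel: "\<And>x. (\<Sum>n\<in>F. (cmod (cinner x (f n)))\<^sup>2) \<le> C * (norm x)\<^sup>2"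
    and C: "0 \<le> C" and B: "bounded_clinear B"
  shows "(\<Sum>n\<in>F. (cmod (cinner x (B (f n))))\<^sup>2) \<le> C * (onorm B)\<^sup>2 * (norm x)\<^sup>2"
proof -
  define a where "a n = cinner x (B (f n))" for n
  define v where "v = (\<Sum>n\<in>F. a n *\<^sub>C f n)"
  define s where "s = (\<Sum>n\<in>F. (cmod (a n))\<^sup>2)"
  have B_lin: "bounded_linear B" and hom: "B (c *\<^sub>C y) = c *\<^sub>C B y" for c y
    using B by (simp_all add: bounded_clinear_def)
  have s0: "0 \<le> s"
    unfolding s_def by (simp add: sum_nonneg)
  have "complex_of_real s = (\<Sum>n\<in>F. a n * cinner (B (f n)) x)"
    unfolding s_def of_real_sum complex_norm_square
    by (simp add: a_def cinner_commute[symmetric])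
  also have "\<dots> = cinner (B v) x"
    by (simp add: v_def linear_sum[OF bounded_linear.linear[OF B_lin]] hom cinner_sum_left
        cinner_scaleC_left)
  finally have "s = cmod (cinner (B v) x)"
    using s0 by (metis abs_of_nonneg norm_of_real)
  also have "\<dots> \<le> norm (B v) * norm x"
    by (rule Cauchy_Schwarz_cinner)
  also have "\<dots> \<le> onorm B * norm v * norm x"
    by (intro mult_right_mono onorm B_lin) simp
  finally have "s\<^sup>2 \<le> (onorm B * norm v * norm x)\<^sup>2"
    using s0 by (rule power_mono)
  also have "\<dots> = (onorm B)\<^sup>2 * (norm x)\<^sup>2 * (norm v)\<^sup>2"
    by (simp add: power_mult_distrib)
  also have "\<dots> \<le> (onorm B)\<^sup>2 * (norm x)\<^sup>2 * (C * s)"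
    unfolding v_def s_def by (intro mult_left_mono norm_synthesis_le Bessel C) simp
  finally have "s * s \<le> s * (C * (onorm B)\<^sup>2 * (norm x)\<^sup>2)"
    by (simp add: power2_eq_square algebra_simps)
  then have "s \<le> C * (onorm B)\<^sup>2 * (norm x)\<^sup>2"
    using s0 C by (cases "s = 0") simp_all
  then show ?thesis
    by (simp add: s_def a_def)
qed

text \<open>Pairing the reconstruction series of \<open>x\<close> with \<open>x\<close> and applying
  Cauchy-Schwarz to its coefficients bounds \<open>(norm x)^4\<close> by
  \<open>K * (norm x)^2\<close> times the frame sum. Hence \<open>inverse K\<close> is a lower frame
  bound.\<close>

lemma recon_Bessel_imp_frame:
  fixes f :: "int \<Rightarrow> 'a::complex_hilbert"
  assumes recon: "does_frame_reconstruction I f B" and B0: "onorm B \<noteq> 0" and C: "0 < C"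
    and summable: "\<And>x. (\<lambda>n. (cmod (cinner x (f n)))\<^sup>2) summable_on I"
    and Bessel: "\<And>x. (\<Sum>\<^sub>\<infinity>n\<in>I. (cmod (cinner x (f n)))\<^sup>2) \<le> C * (norm x)\<^sup>2"
  shows "is_frame I f"
proof -
  have B: "bounded_clinear B"
    using recon by (simp add: does_frame_reconstruction_def)
  define K where "K = C * (onorm B)\<^sup>2"
  have K: "0 < K"
    using C B0 by (simp add: K_def)
  have lower: "(norm x)\<^sup>2 \<le> K * (\<Sum>\<^sub>\<infinity>n\<in>I. (cmod (cinner x (f n)))\<^sup>2)" for x
  proof -
    define s where "s = (\<Sum>\<^sub>\<infinity>n\<in>I. (cmod (cinner x (f n)))\<^sup>2)"
    define p where "p = partial_sum I (\<lambda>n. cinner x (B (f n)) *\<^sub>C f n)"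
    have fin: "(\<Sum>n\<in>I \<inter> {- int N..int N}. (cmod (cinner y (f n)))\<^sup>2)
        \<le> (\<Sum>\<^sub>\<infinity>n\<in>I. (cmod (cinner y (f n)))\<^sup>2)" for N y
      by (rule finite_sum_le_infsum[OF summable]) auto
    have "(cmod (cinner (p N) x))\<^sup>2 \<le> K * (norm x)\<^sup>2 * s" for N
    proof -
      let ?F = "I \<inter> {- int N..int N}"
      have "cmod (cinner (p N) x) \<le> (\<Sum>n\<in>?F. cmod (cinner x (B (f n))) * cmod (cinner x (f n)))"
        unfolding p_def partial_sum_def cinner_sum_left cinner_scaleC_left
        by (rule order_trans[OF norm_sum]) (simp add: norm_mult cmod_cinner_commute)
      then have "(cmod (cinner (p N) x))\<^sup>2
          \<le> (\<Sum>n\<in>?F. cmod (cinner x (B (f n))) * cmod (cinner x (f n)))\<^sup>2"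
        by (rule power_mono) simp
      also have "\<dots> \<le> (\<Sum>n\<in>?F. (cmod (cinner x (B (f n))))\<^sup>2) * (\<Sum>n\<in>?F. (cmod (cinner x (f n)))\<^sup>2)"
        by (rule Cauchy_Schwarz_ineq_sum)
      also have "\<dots> \<le> (K * (norm x)\<^sup>2) * s"
      proof (rule mult_mono)
        show "(\<Sum>n\<in>?F. (cmod (cinner x (B (f n))))\<^sup>2) \<le> K * (norm x)\<^sup>2"
          unfolding K_def using C
          by (intro analysis_sum_le B order_trans[OF fin Bessel]) simp
        show "(\<Sum>n\<in>?F. (cmod (cinner x (f n)))\<^sup>2) \<le> s"
          unfolding s_def by (rule fin)
      qed (use K in \<open>auto intro: sum_nonneg\<close>)
      finally show ?thesis .
    qed
    \<comment> \<open>Only here does reconstruction enter: it identifies the limit, and the bound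
      uniform in \<open>N\<close> passes to it.\<close>
    moreover have "(\<lambda>N. (cmod (cinner (p N) x))\<^sup>2) \<longlonglongrightarrow> (cmod (cinner x x))\<^sup>2"
      using recon unfolding p_def does_frame_reconstruction_def
      by (intro tendsto_power tendsto_norm bounded_linear.tendsto[OF bounded_linear_cinner_left])
        blast
    ultimately have "(cmod (cinner x x))\<^sup>2 \<le> K * (norm x)\<^sup>2 * s"
      by (intro LIMSEQ_le_const2) auto
    then have le: "(norm x)\<^sup>2 * (norm x)\<^sup>2 \<le> (norm x)\<^sup>2 * (K * s)"
      by (simp add: cmod_cinner_self power2_eq_square algebra_simps)
    show ?thesis
    proof (cases "x = 0")
      case False
      then have "0 < (norm x)\<^sup>2"
        by simp
      with le show ?thesis
        unfolding s_def by (rule mult_left_le_imp_le)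
    qed simp
  qed
  show ?thesis
    unfolding is_frame_def
  proof (rule exI[of _ "inverse K"], intro exI[of _ C] conjI allI)
    show "inverse K * (norm x)\<^sup>2 \<le> (\<Sum>\<^sub>\<infinity>n\<in>I. (cmod (cinner x (f n)))\<^sup>2)" for x
      using lower[of x] K by (simp add: field_simps)
  qed (use K C summable Bessel in auto)
qed

text \<open>Split \<open>f n\<close> as \<open>h n\<close> plus the difference and use
  \<open>(a + b)^2 \<le> 2 a^2 + 2 b^2\<close>. The squared differences have sum at most the square
  of the sum of their norms, since each norm is at most that sum.\<close>

lemma Bessel_perturbation:
  fixes f h :: "int \<Rightarrow> 'a::complex_hilbert"
  assumes summable: "(\<lambda>n. norm (f n - h n)) summable_on I"
    and h: "(\<lambda>n. (cmod (cinner x (h n)))\<^sup>2) summable_on I"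
      "(\<Sum>\<^sub>\<infinity>n\<in>I. (cmod (cinner x (h n)))\<^sup>2) \<le> C * (norm x)\<^sup>2"
  shows "(\<lambda>n. (cmod (cinner x (f n)))\<^sup>2) summable_on I"
    and "(\<Sum>\<^sub>\<infinity>n\<in>I. (cmod (cinner x (f n)))\<^sup>2)
      \<le> (2 * C + 2 * (\<Sum>\<^sub>\<infinity>n\<in>I. norm (f n - h n))\<^sup>2) * (norm x)\<^sup>2"
proof -
  define S where "S = (\<Sum>\<^sub>\<infinity>n\<in>I. norm (f n - h n))"
  have e_le: "norm (f n - h n) \<le> S" if "n \<in> I" for n
    using finite_sum_le_infsum[OF summable, of "{n}"] that by (simp add: S_def)
  \<comment> \<open>One factor \<open>norm (f n - h n)\<close> is replaced by \<open>S\<close>,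
    which leaves a majorant linear in the summable norms.\<close>
  let ?b = "\<lambda>n. 2 * (cmod (cinner x (h n)))\<^sup>2 + 2 * (norm x)\<^sup>2 * S * norm (f n - h n)"
  have term_le: "(cmod (cinner x (f n)))\<^sup>2 \<le> ?b n" if "n \<in> I" for n
  proof -
    have "cmod (cinner x (f n)) \<le> cmod (cinner x (h n)) + cmod (cinner x (f n - h n))"
      using norm_triangle_ineq[of "cinner x (h n)" "cinner x (f n - h n)"]
      by (simp add: cinner_diff_right)
    then have "(cmod (cinner x (f n)))\<^sup>2 \<le> (cmod (cinner x (h n)) + cmod (cinner x (f n - h n)))\<^sup>2"
      by (rule power_mono) simp
    also have "\<dots> \<le> 2 * (cmod (cinner x (h n)))\<^sup>2 + 2 * (cmod (cinner x (f n - h n)))\<^sup>2"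
      by (smt (verit) sum_squares_bound power2_sum)
    also have "(cmod (cinner x (f n - h n)))\<^sup>2 \<le> (norm x * norm (f n - h n))\<^sup>2"
      by (intro power_mono Cauchy_Schwarz_cinner) simp
    also have "\<dots> = (norm x)\<^sup>2 * (norm (f n - h n) * norm (f n - h n))"
      by (simp add: power2_eq_square algebra_simps)
    also have "\<dots> \<le> (norm x)\<^sup>2 * (S * norm (f n - h n))"
      by (intro mult_left_mono mult_right_mono e_le that) simp_all
    finally show ?thesis
      by (simp add: mult.assoc)
  qed
  have b: "?b summable_on I"
    by (intro summable_on_add summable_on_cmult_right h summable)
  show fsum: "(\<lambda>n. (cmod (cinner x (f n)))\<^sup>2) summable_on I"
    by (rule summable_on_comparison_test[OF b]) (simp_all add: term_le)
  have "(\<Sum>\<^sub>\<infinity>n\<in>I. (cmod (cinner x (f n)))\<^sup>2) \<le> infsum ?b I"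
    by (intro infsum_mono fsum b term_le)
  also have "\<dots> = 2 * (\<Sum>\<^sub>\<infinity>n\<in>I. (cmod (cinner x (h n)))\<^sup>2) + 2 * (norm x)\<^sup>2 * S * S"
    by (simp add: infsum_add infsum_cmult_right summable_on_cmult_right h summable S_def)
  also have "\<dots> \<le> 2 * (C * (norm x)\<^sup>2) + 2 * (norm x)\<^sup>2 * S * S"
    using h(2) by simp
  finally show "(\<Sum>\<^sub>\<infinity>n\<in>I. (cmod (cinner x (f n)))\<^sup>2)
      \<le> (2 * C + 2 * (\<Sum>\<^sub>\<infinity>n\<in>I. norm (f n - h n))\<^sup>2) * (norm x)\<^sup>2"
    by (simp add: S_def[symmetric] power2_eq_square algebra_simps)
qed

section \<open>Perturbation of frame reconstruction\<close>

text \<open>Squaring \<open>2 S + M \<le> sqrt (M^2 + 1/b)\<close> yields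
  \<open>4 b (M S + S^2) \<le> 1\<close>. The left side of the claim is
  \<open>2 b M S + b S^2\<close>, at most half of this product.\<close>

lemma perturbation_bound:
  fixes S M b :: real
  assumes "0 \<le> S" "0 \<le> M" "0 < b" "S \<le> 1 / 2 * (sqrt (M\<^sup>2 + 1 / b) - M)"
  shows "b * M * S + b * (M + S) * S \<le> 1 / 2"
proof -
  have "2 * S + M \<le> sqrt (M\<^sup>2 + 1 / b)"
    using assms by simp
  then have "(2 * S + M)\<^sup>2 \<le> M\<^sup>2 + 1 / b"
    using assms power_mono[of "2 * S + M" "sqrt (M\<^sup>2 + 1 / b)" 2] by simp
  then have "4 * (M * S + S * S) \<le> 1 / b"
    by (simp add: power2_eq_square algebra_simps)
  then have "4 * (M * S + S * S) * b \<le> 1"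
    using assms by (simp add: pos_le_divide_eq)
  moreover have "0 \<le> b * (S * S)"
    using assms by simp
  ultimately show ?thesis
    by (simp add: algebra_simps)
qed

text \<open>\<open>lim\<close>, \<open>infsum\<close> and \<open>SUP\<close> are total, so
  convergence is part of the conclusion, while summability and boundedness are explicit
  hypotheses.\<close>

theorem theorem5p1:
  fixes I :: "int set"
    and f h :: "int \<Rightarrow> 'a::complex_hilbert"
    and B T :: "'a \<Rightarrow> 'a"
    and M :: real
  assumes nontrivial: "\<exists>x::'a. x \<noteq> 0"
    and index: "I = \<nat> \<or> I = \<int>"
    and recon: "does_frame_reconstruction I f B"
    and bounded: "bdd_above ((\<lambda>n. norm (f n)) ` I)"
    and M: "M = (SUP n\<in>I. norm (f n))"
    and summable: "(\<lambda>n. norm (f n - h n)) summable_on I"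
    and close: "(\<Sum>\<^sub>\<infinity>n\<in>I. norm (f n - h n)) \<le> 1 / 2 * (sqrt (M\<^sup>2 + 1 / onorm B) - M)"
    and T: "\<And>x. T x = lim (partial_sum I (\<lambda>n. cinner x (B (h n)) *\<^sub>C h n))"
  shows "(\<forall>x. convergent (partial_sum I (\<lambda>n. cinner x (B (h n)) *\<^sub>C h n)))
    \<and> bounded_clinear T \<and> bij T \<and> bounded_clinear (inv T)
    \<and> does_frame_reconstruction I h (cadjoint (inv T) \<circ> B)
    \<and> (does_unconditional_frame_reconstruction I f B \<longrightarrow>
        does_unconditional_frame_reconstruction I h (cadjoint (inv T) \<circ> B))
    \<and> (\<not> is_frame I f \<longrightarrow> \<not> is_frame I h)"
proof -
  define e where "e n = f n - h n" for n
  define S where "S = (\<Sum>\<^sub>\<infinity>n\<in>I. norm (e n))"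
  have e_summable: "(\<lambda>n. norm (e n)) summable_on I"
    using summable by (simp add: e_def)
  have S0: "0 \<le> S"
    unfolding S_def by (rule infsum_nonneg) simp
  have f_le: "norm (f n) \<le> M" if "n \<in> I" for n
    unfolding M using bounded that by (intro cSUP_upper) simp_all
  \<comment> \<open>The index 0 lies in both possible index sets, so \<open>M\<close> dominates an
    actual norm.\<close>
  have M0: "0 \<le> M"
    using index f_le[of 0] order_trans[OF norm_ge_zero] by fastforce
  have e_le: "norm (e n) \<le> S" if "n \<in> I" for n
    using finite_sum_le_infsum[OF e_summable, of "{n}"] that by (simp add: S_def)
  have h_le: "norm (h n) \<le> M + S" if "n \<in> I" for n
    using norm_triangle_ineq4[of "f n" "e n"] f_le[OF that] e_le[OF that] by (simp add: e_def)
  have B: "bounded_clinear B"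
    using recon by (simp add: does_frame_reconstruction_def)
  then have B_lin: "bounded_linear B" and B_hom: "B (c *\<^sub>C x) = c *\<^sub>C B x" for c x
    by (simp_all add: bounded_clinear_def)
  have B_diff: "B (x - y) = B x - B y" for x y
    by (rule linear_diff[OF bounded_linear.linear[OF B_lin]])
  \<comment> \<open>If \<open>B\<close> vanished, every reconstruction series would be zero,
    contradicting nontriviality; hence \<open>1 / onorm B\<close> is a genuine quotient.\<close>
  have onorm_B0: "onorm B \<noteq> 0"
  proof
    assume "onorm B = 0"
    then have "B = (\<lambda>x. 0)"
      using onorm_eq_0[OF B_lin] by auto
    then have "partial_sum I (\<lambda>n. cinner x (B (f n)) *\<^sub>C f n) = (\<lambda>N. 0)" for x
      by (simp add: partial_sum_def fun_eq_iff)
    then have "(\<lambda>N. 0) \<longlonglongrightarrow> x" for x :: 'a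
      using recon unfolding does_frame_reconstruction_def by metis
    with nontrivial show False
      by (metis LIMSEQ_const_iff)
  qed
  then have onorm_B: "0 < onorm B"
    using onorm_pos_le[OF B_lin] by simp

  \<comment> \<open>Both families are dominated by multiples of \<open>norm (e n)\<close>; the two
    constants match \<open>perturbation_bound\<close> with \<open>b = onorm B\<close>.\<close>
  have le1: "norm (B (f n)) * norm (e n) \<le> onorm B * M * norm (e n)" if "n \<in> I" for n
    using onorm_B
    by (intro mult_right_mono order_trans[OF onorm[OF B_lin] mult_left_mono] f_le that) simp_all
  have le2: "norm (B (e n)) * norm (h n) \<le> onorm B * (M + S) * norm (e n)" if "n \<in> I" for n
  proof -
    have "norm (B (e n)) * norm (h n) \<le> (onorm B * norm (e n)) * (M + S)"
      using onorm_B by (intro mult_mono onorm B_lin h_le that) auto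
    then show ?thesis
      by (simp add: algebra_simps)
  qed
  have sum1: "(\<lambda>n. norm (B (f n)) * norm (e n)) summable_on I"
    by (rule summable_on_comparison_test[OF summable_on_cmult_right[OF e_summable] le1]) simp_all
  have sum2: "(\<lambda>n. norm (B (e n)) * norm (h n)) summable_on I"
    by (rule summable_on_comparison_test[OF summable_on_cmult_right[OF e_summable] le2]) simp_all
  have sum1': "(\<lambda>n. norm (e n) * norm (B (f n))) summable_on I"
    and sum2': "(\<lambda>n. norm (h n) * norm (B (e n))) summable_on I"
    using sum1 sum2 by (simp_all add: mult.commute)
  have inf1: "(\<Sum>\<^sub>\<infinity>n\<in>I. norm (B (f n)) * norm (e n)) \<le> onorm B * M * S"
    unfolding S_def infsum_cmult_right[OF e_summable, symmetric]
    by (intro infsum_mono sum1 summable_on_cmult_right e_summable le1)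
  have inf2: "(\<Sum>\<^sub>\<infinity>n\<in>I. norm (B (e n)) * norm (h n)) \<le> onorm B * (M + S) * S"
    using infsum_mono[OF sum2 summable_on_cmult_right[OF e_summable] le2]
    by (simp add: infsum_cmult_right[OF e_summable] S_def)

  define D where "D x = nuclear I (\<lambda>n. B (f n)) e x + nuclear I (\<lambda>n. B (e n)) h x" for x
  \<comment> \<open>The adjoint of \<open>D\<close>, obtained by exchanging the two families in each
    series.\<close>
  define D' where "D' x = nuclear I e (\<lambda>n. B (f n)) x + nuclear I h (\<lambda>n. B (e n)) x" for x
  have D_clin: "bounded_clinear D" and D'_clin: "bounded_clinear D'"
    unfolding D_def D'_def
    by (intro bounded_clinear_add bounded_clinear_nuclear sum1 sum2 sum1' sum2')+
  have D_adj: "cinner (D x) y = cinner x (D' y)" for x y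
    by (simp add: D_def D'_def cinner_add_left cinner_add_right cinner_nuclear sum1 sum2)
  have D_le: "norm (D x) \<le> 1 / 2 * norm x" for x
  proof -
    have "norm (D x) \<le> (\<Sum>\<^sub>\<infinity>n\<in>I. norm (B (f n)) * norm (e n)) * norm x
        + (\<Sum>\<^sub>\<infinity>n\<in>I. norm (B (e n)) * norm (h n)) * norm x"
      unfolding D_def by (intro norm_triangle_mono norm_nuclear_le sum1 sum2)
    also have "\<dots> \<le> (onorm B * M * S + onorm B * (M + S) * S) * norm x"
      using mult_right_mono[OF add_mono[OF inf1 inf2] norm_ge_zero[of x]]
      by (simp only: distrib_right)
    also have "\<dots> \<le> 1 / 2 * norm x"
      using close S0 M0 onorm_B
      by (intro mult_right_mono perturbation_bound) (simp_all add: S_def e_def)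
    finally show ?thesis .
  qed
  have D'_le: "norm (D' x) \<le> 1 / 2 * norm x" for x
    by (rule adjoint_norm_le[OF D_adj D_le])

  let ?t = "\<lambda>x n. cinner x (B (h n)) *\<^sub>C h n"
  let ?g = "\<lambda>x n. cinner x (B (f n)) *\<^sub>C f n"
  let ?d = "\<lambda>x n. cinner x (B (f n)) *\<^sub>C e n + cinner x (B (e n)) *\<^sub>C h n"
  \<comment> \<open>The series for \<open>h\<close> differs from the one for \<open>f\<close> by an
    unconditionally summable series, so it inherits either mode of convergence; the limit becomes
    \<open>x - D x\<close>.\<close>
  have t_eq: "?t x = (\<lambda>n. ?g x n - ?d x n)" for x
    by (simp add: e_def fun_eq_iff B_diff cinner_diff_right scaleC_diff_left scaleC_diff_right)
  have d_summable: "?d x summable_on I" for x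
    by (intro summable_on_add nuclear_summable sum1 sum2)
  have "partial_sum I (?d x) \<longlonglongrightarrow> D x" for x
    using partial_sum_tendsto_infsum[OF d_summable]
    by (simp add: D_def nuclear_def infsum_add nuclear_summable sum1 sum2)
  then have "(\<lambda>N. partial_sum I (?g x) N - partial_sum I (?d x) N) \<longlonglongrightarrow> x - D x" for x
    using recon by (intro tendsto_diff) (simp_all add: does_frame_reconstruction_def)
  then have t_lim: "partial_sum I (?t x) \<longlonglongrightarrow> x - D x" for x
    unfolding t_eq partial_sum_diff .
  then have T_eq: "T = (\<lambda>x. x - D x)"
    by (simp add: fun_eq_iff T limI)
  define T' where "T' = (\<lambda>x. x - D' x)"
  have bij: "bij T" and inv_clin: "bounded_clinear (inv T)"
    unfolding T_eq using Neumann_inverse[OF D_clin D_le] by simp_all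
  have bij': "bij T'" and inv_clin': "bounded_clinear (inv T')"
    unfolding T'_def using Neumann_inverse[OF D'_clin D'_le] by simp_all
  have T_adj: "cinner (T x) y = cinner x (T' y)" for x y
    by (simp add: T_eq T'_def cinner_diff_left cinner_diff_right D_adj)
  have inv_adj: "cinner (inv T x) y = cinner x (inv T' y)" for x y
    by (rule cinner_inv_left[OF T_adj bij bij'])
  then have adj: "cadjoint (inv T) = inv T'"
    by (rule cadjoint_eqI)
  \<comment> \<open>Moving the adjoint across turns the new reconstruction series at
    \<open>x\<close> into the series of \<open>T\<close> at \<open>inv T x\<close>, whose sum is
    \<open>x\<close>.\<close>
  have shift: "(\<lambda>n. cinner x ((cadjoint (inv T) \<circ> B) (h n)) *\<^sub>C h n) = ?t (inv T x)" for x
    by (simp add: adj inv_adj)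
  have recon_h: "does_frame_reconstruction I h (cadjoint (inv T) \<circ> B)"
    unfolding does_frame_reconstruction_def shift
  proof (intro conjI allI)
    show "bounded_clinear (cadjoint (inv T) \<circ> B)"
      unfolding adj by (rule bounded_clinear_compose[OF inv_clin' B])
    show "partial_sum I (?t (inv T x)) \<longlonglongrightarrow> x" for x
      using t_lim[of "inv T x"] surj_f_inv_f[OF bij_is_surj[OF bij], of x] by (simp add: T_eq)
  qed
  show ?thesis
  proof (intro conjI impI allI)
    show "convergent (partial_sum I (?t x))" for x
      using t_lim by (rule convergentI)
    show "bounded_clinear T"
      unfolding T_eq by (rule bounded_clinear_id_diff[OF D_clin])
    show "does_unconditional_frame_reconstruction I h (cadjoint (inv T) \<circ> B)"
      if "does_unconditional_frame_reconstruction I f B"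
      using that recon_h d_summable
      unfolding does_unconditional_frame_reconstruction_def shift t_eq
      by (auto intro: summable_on_diff)
    show "\<not> is_frame I h" if "\<not> is_frame I f"
    proof
      assume "is_frame I h"
      then obtain C where C: "0 < C" and h: "(\<lambda>n. (cmod (cinner x (h n)))\<^sup>2) summable_on I"
          "(\<Sum>\<^sub>\<infinity>n\<in>I. (cmod (cinner x (h n)))\<^sup>2) \<le> C * (norm x)\<^sup>2" for x
        unfolding is_frame_def by blast
      \<comment> \<open>Only the upper bound of \<open>h\<close> is transferred to \<open>f\<close>;
        the lower bound for \<open>f\<close> comes from its own reconstruction property.\<close>
      have "is_frame I f"
        by (rule recon_Bessel_imp_frame[OF recon onorm_B0 _ Bessel_perturbation[OF summable h]])
          (use C in \<open>simp add: add_pos_nonneg\<close>)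
      with that show False ..
    qed
  qed (rule bij inv_clin recon_h)+
qed

end
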